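(* Let $X$ be a Banach space and let $Y \subset X$ be an $M$-ideal in $X$. If $Y^*$ has $w^*$-$BHP$, then $X^*$ has $w^*$-$BHP$.
   Context: All Banach spaces (including the subspace $Y$) are real and nontrivial ($\neq \{0\}$). $B_{X^*}$ denotes the closed unit ball of the dual $X^*$. $M$-ideal: for a closed subspace $Y \subset X$ let $Y^\perp = \{x^* \in X^* : x^*(y) = 0 \ \forall y \in Y\}$. A linear projection $P$ on a Banach space $Z$ is an $L$-projection if $\|z\| = \|Pz\| + \|z - Pz\|$ for all $z \in Z$. A closed subspace $Y \subset X$ is an $M$-ideal in $X$ if there is an $L$-projection $P : X^* \to X^*$ with $\ker P = Y^\perp$. $w^*$-ball huskable property: a dual space $X^*$ has $w^*$-$BHP$ if for every $\varepsilon > 0$ there is a nonempty relatively $w^*$-open subset of $B_{X^*}$ (with respect to the topology $\sigma(X^*,X)$) with (norm) diameter less than $\varepsilon$. For $Y^*$ the $w^*$-topology is $\sigma(Y^*,Y)$. *)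

theory Defs
  imports "HOL-Analysis.Analysis"
begin

section \<open>M-ideals\<close>

text \<open>The dual of a whole space is the type of bounded linear functionals with the operator norm.\<close>

definition annihilator :: "'a::real_normed_vector set \<Rightarrow> ('a \<Rightarrow>\<^sub>L real) set" where
  "annihilator Y = {f. \<forall>y\<in>Y. blinfun_apply f y = 0}"

definition L_projection :: "('z::real_normed_vector \<Rightarrow> 'z) \<Rightarrow> bool" where
  "L_projection P \<longleftrightarrow> linear P \<and> P \<circ> P = P \<and> (\<forall>z. norm z = norm (P z) + norm (z - P z))"

definition M_ideal :: "'a::real_normed_vector set \<Rightarrow> bool" where
  "M_ideal Y \<longleftrightarrow> subspace Y \<and> closed Y \<and>
     (\<exists>P :: ('a \<Rightarrow>\<^sub>L real) \<Rightarrow> ('a \<Rightarrow>\<^sub>L real). L_projection P \<and> {f. P f = 0} = annihilator Y)"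

section \<open>The dual of a linear subspace and its weak-star topology\<close>

text \<open>
  A subspace \<open>V\<close> of a normed space is a set rather than a type, so its dual is a set of
  functions. They are made \<^const>\<open>extensional\<close> on \<open>V\<close> so that equality is equality on \<open>V\<close>.
  The definitions are meant for linear subspaces \<open>V\<close>; \<open>V = UNIV\<close> gives the dual of the
  whole space.
\<close>

definition dual_space :: "'a::real_normed_vector set \<Rightarrow> ('a \<Rightarrow> real) set" where
  "dual_space V = {f \<in> extensional V.
     (\<forall>x\<in>V. \<forall>y\<in>V. f (x + y) = f x + f y) \<and>
     (\<forall>c. \<forall>x\<in>V. f (c *\<^sub>R x) = c * f x) \<and>
     (\<exists>K. \<forall>x\<in>V. \<bar>f x\<bar> \<le> K * norm x)}"

definition dual_norm :: "'a::real_normed_vector set \<Rightarrow> ('a \<Rightarrow> real) \<Rightarrow> real" where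
  "dual_norm V f = (SUP x \<in> V \<inter> cball 0 1. \<bar>f x\<bar>)"

definition dual_ball :: "'a::real_normed_vector set \<Rightarrow> ('a \<Rightarrow> real) set" where
  "dual_ball V = {f \<in> dual_space V. dual_norm V f \<le> 1}"

text \<open>
  The norm diameter of a nonempty norm-bounded set of functionals on \<open>V\<close>. The pointwise
  difference need not be extensional, but \<^const>\<open>dual_norm\<close> only evaluates it on \<open>V\<close>.
\<close>

definition dual_diameter :: "'a::real_normed_vector set \<Rightarrow> ('a \<Rightarrow> real) set \<Rightarrow> real" where
  "dual_diameter V S = (SUP (f, g) \<in> S \<times> S. dual_norm V (\<lambda>x. f x - g x))"

text \<open>The topology of pointwise convergence on \<open>V\<close>, that is, \<open>\<sigma>(V\<^sup>*, V)\<close>.\<close>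

definition weak_star_topology :: "'a::real_normed_vector set \<Rightarrow> ('a \<Rightarrow> real) topology" where
  "weak_star_topology V = subtopology (powertop_real V) (dual_space V)"

text \<open>\<open>weak_star_BHP V\<close> says that the dual of \<open>V\<close> has the weak-star ball huskable property.\<close>

definition weak_star_BHP :: "'a::real_normed_vector set \<Rightarrow> bool" where
  "weak_star_BHP V \<longleftrightarrow> (\<forall>\<epsilon>>0. \<exists>U.
     openin (subtopology (weak_star_topology V) (dual_ball V)) U \<and> U \<noteq> {} \<and>
     dual_diameter V U < \<epsilon>)"

section \<open>The case of the whole space\<close>

text \<open>
  For \<open>V = UNIV\<close> these notions are the usual ones on the type of bounded linear functionals;
  its \<^const>\<open>strong_operator_topology\<close> is the weak-star topology.
\<close>

lemma range_blinfun_apply_eq_dual_space: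
  "range (blinfun_apply :: ('a::real_normed_vector \<Rightarrow>\<^sub>L real) \<Rightarrow> _) = dual_space UNIV"
proof (intro equalityI subsetI)
  fix f assume "f \<in> range (blinfun_apply :: ('a \<Rightarrow>\<^sub>L real) \<Rightarrow> _)"
  then obtain g :: "'a \<Rightarrow>\<^sub>L real" where f: "f = blinfun_apply g" by blast
  have "\<forall>x. \<bar>g x\<bar> \<le> norm g * norm x"
    using norm_blinfun[of g] by simp
  then show "f \<in> dual_space UNIV"
    unfolding f dual_space_def by (auto simp: blinfun.add_right blinfun.scaleR_right)
next
  fix f :: "'a \<Rightarrow> real" assume "f \<in> dual_space UNIV"
  then obtain K where "\<And>x y. f (x + y) = f x + f y" "\<And>c x. f (c *\<^sub>R x) = c * f x"
    "\<And>x. \<bar>f x\<bar> \<le> K * norm x"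
    unfolding dual_space_def by auto
  then have "bounded_linear f"
    by (intro bounded_linear_intro[where K = K]) (auto simp: mult.commute)
  then show "f \<in> range blinfun_apply"
    by (metis bounded_linear_Blinfun_apply rangeI)
qed

lemma dual_norm_blinfun_apply:
  fixes f :: "'a::real_normed_vector \<Rightarrow>\<^sub>L real"
  shows "dual_norm UNIV (blinfun_apply f) = norm f"
proof -
  let ?B = "cball (0::'a) 1"
  have le: "\<bar>f x\<bar> \<le> norm f" if "x \<in> ?B" for x
    using norm_blinfun[of f x] that mult_left_le[of "norm x" "norm f"] by simp
  then have bdd: "bdd_above ((\<lambda>x. \<bar>f x\<bar>) ` ?B)"
    by (intro bdd_aboveI2[where M = "norm f"])
  let ?S = "SUP x\<in>?B. \<bar>f x\<bar>"
  have up: "\<bar>f x\<bar> \<le> ?S" if "x \<in> ?B" for x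
    using bdd that by (rule cSUP_upper2) auto
  have S0: "0 \<le> ?S"
    using up[of 0] by simp
  have "?S \<le> norm f"
    by (rule cSUP_least) (use le in auto)
  moreover have "norm f \<le> ?S"
  proof (rule norm_blinfun_bound[OF S0])
    fix x
    show "norm (f x) \<le> ?S * norm x"
    proof (cases "x = 0")
      case False
      have "\<bar>f (x /\<^sub>R norm x)\<bar> \<le> ?S"
        using False by (intro up) simp
      then show ?thesis
        using False by (simp add: blinfun.scaleR_right abs_mult field_simps)
    qed simp
  qed
  ultimately show ?thesis
    by (simp add: dual_norm_def)
qed

lemma dual_ball_UNIV:
  "dual_ball UNIV = blinfun_apply ` cball (0 :: 'a::real_normed_vector \<Rightarrow>\<^sub>L real) 1"
  unfolding dual_ball_def range_blinfun_apply_eq_dual_space[symmetric]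
  by (auto simp: dual_norm_blinfun_apply)

lemma dual_diameter_UNIV:
  fixes U :: "('a::real_normed_vector \<Rightarrow>\<^sub>L real) set"
  assumes "U \<noteq> {}"
  shows "dual_diameter UNIV (blinfun_apply ` U) = diameter U"
proof -
  have "dual_norm UNIV (\<lambda>x. f x - g x) = dist f g" for f g :: "'a \<Rightarrow>\<^sub>L real"
    unfolding dist_norm dual_norm_blinfun_apply[symmetric] by (simp add: dual_norm_def blinfun.diff_left)
  moreover have "blinfun_apply ` U \<times> blinfun_apply ` U =
      (\<lambda>(f, g). (blinfun_apply f, blinfun_apply g)) ` (U \<times> U)"
    by auto
  ultimately show ?thesis
    using assms by (simp add: dual_diameter_def diameter_def image_image case_prod_unfold)
qed

lemma openin_weak_star_ball_UNIV:
  fixes U :: "('a::real_normed_vector \<Rightarrow>\<^sub>L real) set"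
  shows "openin (subtopology (weak_star_topology UNIV) (dual_ball UNIV)) (blinfun_apply ` U) \<longleftrightarrow>
    openin (subtopology strong_operator_topology (cball 0 1)) U"
proof -
  have inj: "inj (blinfun_apply :: ('a \<Rightarrow>\<^sub>L real) \<Rightarrow> _)"
    by (simp add: blinfun_apply_inject inj_on_def)
  have sub: "dual_space UNIV \<inter> dual_ball (UNIV::'a set) = dual_ball UNIV"
    by (auto simp: dual_ball_def)
  have "blinfun_apply ` U = T \<inter> blinfun_apply ` cball 0 1 \<longleftrightarrow>
      U = blinfun_apply -` T \<inter> cball 0 1" for T
  proof -
    have "T \<inter> blinfun_apply ` cball 0 1 = blinfun_apply ` (blinfun_apply -` T \<inter> cball 0 1)"
      by blast
    then show ?thesis
      using inj_image_eq_iff[OF inj] by metis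
  qed
  then have eq: "(\<exists>T. open T \<and> blinfun_apply ` U = T \<inter> blinfun_apply ` cball 0 1) \<longleftrightarrow>
      (\<exists>T. open T \<and> U = blinfun_apply -` T \<inter> cball 0 1)"
    by simp
  have "openin (subtopology (weak_star_topology UNIV) (dual_ball UNIV)) (blinfun_apply ` U) \<longleftrightarrow>
      (\<exists>T. open T \<and> blinfun_apply ` U = T \<inter> blinfun_apply ` cball 0 1)"
    by (simp only: weak_star_topology_def subtopology_subtopology sub euclidean_product_topology
        openin_subtopology open_openin) (simp only: dual_ball_UNIV)
  moreover have "openin (subtopology strong_operator_topology (cball 0 1)) U \<longleftrightarrow>
      (\<exists>T. open T \<and> U = blinfun_apply -` T \<inter> cball 0 1)"
    by (auto simp: openin_subtopology strong_operator_topology_def openin_pullback_topology)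
  ultimately show ?thesis
    using eq by simp
qed

lemma weak_star_BHP_UNIV_iff:
  "weak_star_BHP (UNIV :: 'a::real_normed_vector set) \<longleftrightarrow>
    (\<forall>\<epsilon>>0. \<exists>U :: ('a \<Rightarrow>\<^sub>L real) set.
      openin (subtopology strong_operator_topology (cball 0 1)) U \<and> U \<noteq> {} \<and> diameter U < \<epsilon>)"
proof -
  have "(\<exists>W. openin (subtopology (weak_star_topology UNIV) (dual_ball UNIV)) W \<and> W \<noteq> {} \<and>
        dual_diameter (UNIV::'a set) W < \<epsilon>) \<longleftrightarrow>
      (\<exists>U :: ('a \<Rightarrow>\<^sub>L real) set. openin (subtopology strong_operator_topology (cball 0 1)) U \<and>
        U \<noteq> {} \<and> diameter U < \<epsilon>)" (is "?L \<longleftrightarrow> ?R") for \<epsilon>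
  proof
    assume ?L
    then obtain W where W: "openin (subtopology (weak_star_topology UNIV) (dual_ball UNIV)) W"
      "W \<noteq> {}" "dual_diameter (UNIV::'a set) W < \<epsilon>" by blast
    have "W \<subseteq> blinfun_apply ` cball 0 1"
      using openin_subset[OF W(1)] unfolding topspace_subtopology dual_ball_UNIV by blast
    then obtain U where "W = blinfun_apply ` U"
      by (meson subset_imageE)
    with W show ?R
      by (auto simp: openin_weak_star_ball_UNIV dual_diameter_UNIV)
  next
    assume ?R
    then obtain U :: "('a \<Rightarrow>\<^sub>L real) set" where
      "openin (subtopology strong_operator_topology (cball 0 1)) U" "U \<noteq> {}" "diameter U < \<epsilon>"
      by blast
    then show ?L
      by (intro exI[of _ "blinfun_apply ` U"])
        (simp add: openin_weak_star_ball_UNIV dual_diameter_UNIV)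
  qed
  then show ?thesis
    by (simp add: weak_star_BHP_def)
qed

end

theory Submission
  imports Defs
begin

text \<open>
  Write \<open>\<parallel>f\<parallel>\<^sub>Y\<close> for the norm of the restriction of \<open>f \<in> X\<^sup>*\<close> to \<open>Y\<close>, and let \<open>P\<close> be the
  L-projection on \<open>X\<^sup>*\<close> with kernel \<open>Y\<^sup>\<bottom>\<close>. Since \<open>P f\<close> and \<open>f\<close> agree on \<open>Y\<close>, and \<open>P\<close> is a contraction
  with the same value on all extensions of \<open>f|Y\<close>, the functional \<open>P f\<close> is the extension of \<open>f|Y\<close> of
  least norm. By the Hahn--Banach theorem its norm is \<open>\<parallel>f\<parallel>\<^sub>Y\<close>
  (\<open>norm_L_projection_eq_dual_norm\<close>), so that \<open>\<parallel>f\<parallel> = \<parallel>f\<parallel>\<^sub>Y + \<parallel>f - P f\<parallel>\<close>. In the unit ball of \<open>X\<^sup>*\<close>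
  a functional with \<open>\<parallel>f\<parallel>\<^sub>Y > 1 - \<delta>\<close> therefore lies within \<open>\<delta>\<close> of \<open>P f\<close>, and on such functionals
  the norm distance is controlled, up to \<open>2\<delta>\<close>, by the distance of the restrictions to \<open>Y\<close>.

  It remains to pull a small weak-star open piece \<open>W\<close> of the ball of \<open>Y\<^sup>*\<close> back along the
  restriction map and to cut it with the weak-star open condition \<open>f y > 1 - \<delta>\<close> for some \<open>y\<close> in
  the unit ball of \<open>Y\<close>. The result is empty unless \<open>W\<close> reaches close to the unit sphere, and
  \<open>W\<close> may well sit in the interior of the ball. If it does, take a basic neighbourhood \<open>f\<^sub>0 + A\<close>
  whose part in the unit ball lies in \<open>W\<close>. That part contains all points of \<open>f\<^sub>0 + A\<close> at distance
  at most \<open>\<delta>\<close> from \<open>f\<^sub>0\<close>, and \<open>W\<close> has diameter less than \<open>\<delta>\<close>; as \<open>A\<close> is balanced, \<open>A\<close> itself is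
  contained in the ball of radius \<open>\<delta>\<close> (which forces \<open>Y\<close> to be finite-dimensional). One can then
  translate \<open>A\<close> to a functional of norm one. This is \<open>weak_star_BHP_near_sphere\<close>.
\<close>

section \<open>The Hahn--Banach theorem\<close>

text \<open>
  Zorn's lemma is applied to graphs rather than to functions: a linear functional on a subspace
  of \<open>X\<close> is a subspace \<open>G\<close> of \<open>X \<times> \<real>\<close>, and the single condition \<open>a \<le> K * norm x\<close> on its
  elements \<open>(x, a)\<close> encodes both the bound and single-valuedness, since \<open>(0, a)\<close> and \<open>(0, - a)\<close>
  in \<open>G\<close> give \<open>a = 0\<close>.
\<close>

lemma hahn_banach:
  fixes V :: "'a::real_normed_vector set"
  assumes V: "subspace V"
    and add: "\<And>x y. x \<in> V \<Longrightarrow> y \<in> V \<Longrightarrow> f (x + y) = f x + f y"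
    and scale: "\<And>c x. x \<in> V \<Longrightarrow> f (c *\<^sub>R x) = c * f x"
    and bound: "\<And>x. x \<in> V \<Longrightarrow> \<bar>f x\<bar> \<le> K * norm x"
    and K: "K \<ge> 0"
  shows "\<exists>F :: 'a \<Rightarrow>\<^sub>L real. (\<forall>x\<in>V. blinfun_apply F x = f x) \<and> norm F \<le> K"
proof -
  define good :: "('a \<times> real) set \<Rightarrow> bool"
    where "good G \<longleftrightarrow> subspace G \<and> (\<forall>(x, a) \<in> G. a \<le> K * norm x)" for G
  define G0 where "G0 = (\<lambda>x. (x, f x)) ` V"
  have f0: "f 0 = 0"
    using scale[of 0 0] subspace_0[OF V] by simp
  have "subspace G0"
  proof (rule subspaceI)
    show "0 \<in> G0"
      using subspace_0[OF V] f0 by (force simp: G0_def zero_prod_def)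
  qed (auto simp: G0_def add[symmetric] scale[symmetric] subspace_add[OF V] subspace_scale[OF V])
  then have G0: "good G0"
    using bound by (force simp: good_def G0_def)
  have "\<exists>M\<in>{G. good G \<and> G0 \<subseteq> G}. \<forall>G\<in>{G. good G \<and> G0 \<subseteq> G}. M \<subseteq> G \<longrightarrow> G = M"
  proof (rule subset_Zorn_nonempty)
    show "{G. good G \<and> G0 \<subseteq> G} \<noteq> {}"
      using G0 by blast
  next
    fix \<C> assume ne: "\<C> \<noteq> {}" and chain: "subset.chain {G. good G \<and> G0 \<subseteq> G} \<C>"
    have mem: "good G" "G0 \<subseteq> G" if "G \<in> \<C>" for G
      using chain that by (auto simp: subset.chain_def)
    have sub: "subspace G" if "G \<in> \<C>" for G
      using mem(1)[OF that] by (simp add: good_def)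
    have "subspace (\<Union>\<C>)"
    proof (rule subspaceI)
      show "0 \<in> \<Union>\<C>"
        using ne sub subspace_0 by blast
    next
      fix p q assume "p \<in> \<Union>\<C>" "q \<in> \<Union>\<C>"
      then obtain G H where GH: "G \<in> \<C>" "p \<in> G" "H \<in> \<C>" "q \<in> H"
        by blast
      then have "G \<subseteq> H \<or> H \<subseteq> G"
        using chain by (simp add: subset_chain_def)
      then obtain G where "G \<in> \<C>" "p \<in> G" "q \<in> G"
        using GH by blast
      then show "p + q \<in> \<Union>\<C>"
        using sub subspace_add by blast
    next
      fix c p assume "p \<in> \<Union>\<C>"
      then show "c *\<^sub>R p \<in> \<Union>\<C>"
        using sub subspace_scale by blast
    qed
    then show "\<Union>\<C> \<in> {G. good G \<and> G0 \<subseteq> G}"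
      using ne mem by (fastforce simp: good_def)
  qed
  then obtain M where M_mem: "M \<in> {G. good G \<and> G0 \<subseteq> G}"
    and M_max: "\<forall>G\<in>{G. good G \<and> G0 \<subseteq> G}. M \<subseteq> G \<longrightarrow> G = M"
    by (rule bexE)
  have M: "good M" "G0 \<subseteq> M"
    using M_mem by simp_all
  have max: "G = M" if "good G" "G0 \<subseteq> G" "M \<subseteq> G" for G
    using M_max that by simp
  have subM: "subspace M" and boundM: "\<And>x a. (x, a) \<in> M \<Longrightarrow> a \<le> K * norm x"
    using M(1) by (auto simp: good_def)
  have total: "\<exists>a. (x, a) \<in> M" for x
  proof -
    \<comment> \<open>A value at \<open>x\<close> is admissible iff it separates two families of numbers, one from each sign
      of the coefficient of \<open>x\<close>; the supremum of the lower family is such a value.\<close>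
    define c where "c = (SUP (y, a)\<in>M. a - K * norm (y - x))"
    have sep: "a - K * norm (y - x) \<le> K * norm (z + x) - b" if "(y, a) \<in> M" "(z, b) \<in> M" for y a z b
    proof -
      have "a + b \<le> K * norm (y + z)"
        using boundM subspace_add[OF subM that] by simp
      also have "\<dots> \<le> K * (norm (y - x) + norm (z + x))"
        using norm_triangle_ineq[of "y - x" "z + x"] K by (intro mult_left_mono) auto
      finally show ?thesis
        by (simp add: algebra_simps)
    qed
    have 0: "(0, 0) \<in> M"
      using subspace_0[OF subM] by (simp add: zero_prod_def)
    have "bdd_above ((\<lambda>(y, a). a - K * norm (y - x)) ` M)"
      using sep[OF _ 0] by (intro bdd_aboveI) auto
    then have lower: "a - K * norm (y - x) \<le> c" if "(y, a) \<in> M" for y a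
      unfolding c_def using that by (intro cSUP_upper2) auto
    have upper: "c \<le> K * norm (z + x) - b" if "(z, b) \<in> M" for z b
      unfolding c_def using sep[OF _ that] 0 by (intro cSUP_least) auto
    have "good (span (insert (x, c) M))"
      unfolding good_def
    proof (intro conjI ballI)
      fix p assume "p \<in> span (insert (x, c) M)"
      then obtain t where "p - t *\<^sub>R (x, c) \<in> span M"
        using span_breakdown_eq by blast
      then have t: "p - t *\<^sub>R (x, c) \<in> M"
        using subM by (simp add: span_eq_iff[THEN iffD2])
      obtain y a where p: "p = (y + t *\<^sub>R x, a + t * c)" and ya: "(y, a) \<in> M"
        using t by (cases p) (auto intro!: that[of "fst p - t *\<^sub>R x" "snd p - t * c"])
      have "a + t * c \<le> K * norm (y + t *\<^sub>R x)"
      proof (cases t "0::real" rule: linorder_cases)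
        case equal
        then show ?thesis using boundM[OF ya] by simp
      next
        case greater
        have "c \<le> K * norm ((1 / t) *\<^sub>R y + x) - (1 / t) * a"
          using upper subspace_scale[OF subM ya, of "1 / t"] by simp
        moreover have "norm (y + t *\<^sub>R x) = t * norm ((1 / t) *\<^sub>R y + x)"
          using greater norm_scaleR[of t "(1 / t) *\<^sub>R y + x"] by (simp add: scaleR_add_right)
        ultimately show ?thesis
          using greater by (simp add: field_simps)
      next
        case less
        have "(- 1 / t) * a - K * norm ((- 1 / t) *\<^sub>R y - x) \<le> c"
          using lower subspace_scale[OF subM ya, of "- 1 / t"] by simp
        moreover have "norm (y + t *\<^sub>R x) = (- t) * norm ((- 1 / t) *\<^sub>R y - x)"
          using less norm_scaleR[of "- t" "(- 1 / t) *\<^sub>R y - x"] by (simp add: scaleR_diff_right)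
        ultimately show ?thesis
          using less by (simp add: field_simps)
      qed
      then show "case p of (y, a) \<Rightarrow> a \<le> K * norm y"
        by (simp add: p)
    qed simp
    then have "span (insert (x, c) M) = M"
      using M(2) by (intro max) (auto intro: span_base)
    then show ?thesis
      using span_base by blast
  qed
  have unique: "a = b" if "(x, a) \<in> M" "(x, b) \<in> M" for x a b
    using boundM[of 0 "a - b"] boundM[of 0 "b - a"] subspace_diff[OF subM that]
      subspace_diff[OF subM that(2) that(1)] by simp
  define F where "F x = (THE a. (x, a) \<in> M)" for x
  have F: "(x, F x) \<in> M" for x
    unfolding F_def using total unique by (metis theI)
  have F_eq: "F x = a" if "(x, a) \<in> M" for x a
    using that F unique by blast
  have "\<bar>F x\<bar> \<le> K * norm x" for x
    using boundM[OF F[of x]] boundM[of "- x" "- F x"] subspace_neg[OF subM F[of x]] by (auto simp: abs_if)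
  then have bound: "norm (F x) \<le> norm x * K" for x
    by (simp add: mult.commute)
  have "bounded_linear F"
  proof (rule bounded_linear_intro[where K = K])
    show "F (x + y) = F x + F y" for x y
      using subspace_add[OF subM F[of x] F[of y]] by (intro F_eq) simp
    show "F (r *\<^sub>R x) = r *\<^sub>R F x" for r x
      using subspace_scale[OF subM F[of x], of r] by (intro F_eq) simp
  qed (fact bound)
  then have app: "blinfun_apply (Blinfun F) = F"
    by (rule bounded_linear_Blinfun_apply)
  show ?thesis
  proof (intro exI conjI ballI)
    show "blinfun_apply (Blinfun F) x = f x" if "x \<in> V" for x
      unfolding app using that M(2) by (intro F_eq) (auto simp: G0_def)
    show "norm (Blinfun F) \<le> K"
      using bound K by (intro norm_blinfun_bound) (auto simp: app mult.commute)
  qed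
qed


section \<open>Norms of functionals on a subspace\<close>

lemma dual_norm_le:
  assumes "0 \<in> V" "0 \<le> K" "\<And>x. x \<in> V \<Longrightarrow> \<bar>f x\<bar> \<le> K * norm x"
  shows "dual_norm V f \<le> K"
  unfolding dual_norm_def
proof (rule cSUP_least)
  show "V \<inter> cball 0 1 \<noteq> {}"
    using assms(1) by (auto intro!: exI[of _ 0])
  show "\<bar>f x\<bar> \<le> K" if "x \<in> V \<inter> cball 0 1" for x
    using assms(3)[of x] mult_left_le[of "norm x" K] that assms(2) by simp
qed

lemma abs_le_dual_norm:
  assumes V: "subspace V" and f: "f \<in> dual_space V" and x: "x \<in> V"
  shows "\<bar>f x\<bar> \<le> dual_norm V f * norm x"
proof -
  have scale: "f (c *\<^sub>R x) = c * f x" if "x \<in> V" for c x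
    using f that by (simp add: dual_space_def)
  obtain K where K: "\<And>x. x \<in> V \<Longrightarrow> \<bar>f x\<bar> \<le> K * norm x"
    using f unfolding dual_space_def by blast
  have bdd: "bdd_above ((\<lambda>x. \<bar>f x\<bar>) ` (V \<inter> cball 0 1))"
  proof (rule bdd_aboveI2)
    show "\<bar>f x\<bar> \<le> \<bar>K\<bar>" if "x \<in> V \<inter> cball 0 1" for x
      using K[of x] that mult_mono[of K "\<bar>K\<bar>" "norm x" 1] by (auto simp: abs_ge_self)
  qed
  show ?thesis
  proof (cases "x = 0")
    case True
    then show ?thesis
      using scale[OF x, of 0] by simp
  next
    case False
    have "\<bar>f (x /\<^sub>R norm x)\<bar> \<le> dual_norm V f"
      unfolding dual_norm_def using False x subspace_scale[OF V]
      by (intro cSUP_upper bdd) auto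
    then show ?thesis
      using False by (simp add: scale[OF x] abs_mult field_simps)
  qed
qed

lemma dual_norm_restrict: "dual_norm V (restrict f V) = dual_norm V f"
  unfolding dual_norm_def by (intro SUP_cong) auto

lemma dual_norm_nonneg:
  assumes "subspace V" "f \<in> dual_space V"
  shows "0 \<le> dual_norm V f"
proof (cases "V = {0}")
  case True
  have "f (0 *\<^sub>R 0) = 0 * f 0"
    using assms subspace_0 by (fastforce simp: dual_space_def)
  then show ?thesis
    by (simp add: dual_norm_def True)
next
  case False
  then obtain x where "x \<in> V" "x \<noteq> 0"
    using subspace_0[OF assms(1)] by blast
  then have "0 \<le> dual_norm V f * norm x"
    using abs_le_dual_norm[OF assms] by (meson abs_ge_zero order_trans)
  then show ?thesis
    using \<open>x \<noteq> 0\<close> by (simp add: zero_le_mult_iff)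
qed

lemma restrict_blinfun_in_dual_space:
  fixes f :: "'a::real_normed_vector \<Rightarrow>\<^sub>L real"
  assumes "subspace V"
  shows "restrict f V \<in> dual_space V"
  using norm_blinfun[of f] assms
  by (auto simp: dual_space_def blinfun.add_right blinfun.scaleR_right subspace_add subspace_scale)

lemma hahn_banach_dual_space:
  assumes V: "subspace V" and f: "f \<in> dual_space V"
  shows "\<exists>F :: 'a::real_normed_vector \<Rightarrow>\<^sub>L real. (\<forall>x\<in>V. blinfun_apply F x = f x) \<and> norm F \<le> dual_norm V f"
proof (rule hahn_banach[OF V, of f])
  show "f (x + y) = f x + f y" if "x \<in> V" "y \<in> V" for x y
    using f that by (simp add: dual_space_def)
  show "f (c *\<^sub>R x) = c * f x" if "x \<in> V" for c x
    using f that by (simp add: dual_space_def)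
  show "\<bar>f x\<bar> \<le> dual_norm V f * norm x" if "x \<in> V" for x
    by (rule abs_le_dual_norm[OF V f that])
  show "0 \<le> dual_norm V f"
    by (fact dual_norm_nonneg[OF V f])
qed

text \<open>
  For functionals on the whole space, the norm of the restriction to \<open>V\<close> is a seminorm. The
  arguments below take place in the dual of the whole space with this seminorm, which avoids
  handling extensional functions.
\<close>

context
  fixes V :: "'a::real_normed_vector set"
  assumes V: "subspace V"
begin

lemma dual_norm_blinfun_nonneg: "0 \<le> dual_norm V (blinfun_apply f)"
  using dual_norm_nonneg[OF V restrict_blinfun_in_dual_space[OF V, of f]]
  by (simp add: dual_norm_restrict)

lemma abs_blinfun_le_dual_norm:
  assumes "x \<in> V"
  shows "\<bar>blinfun_apply f x\<bar> \<le> dual_norm V (blinfun_apply f) * norm x"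
  using abs_le_dual_norm[OF V restrict_blinfun_in_dual_space[OF V, of f] assms] assms
  by (simp add: dual_norm_restrict)

lemma dual_norm_le_norm: "dual_norm V (blinfun_apply f) \<le> norm f"
  using norm_blinfun[of f] by (intro dual_norm_le subspace_0[OF V]) auto

lemma dual_norm_add_le:
  "dual_norm V (blinfun_apply (f + g)) \<le> dual_norm V (blinfun_apply f) + dual_norm V (blinfun_apply g)"
proof (rule dual_norm_le[OF subspace_0[OF V]])
  show "\<bar>blinfun_apply (f + g) x\<bar> \<le>
      (dual_norm V (blinfun_apply f) + dual_norm V (blinfun_apply g)) * norm x" if "x \<in> V" for x
    using abs_blinfun_le_dual_norm[OF that, of f] abs_blinfun_le_dual_norm[OF that, of g]
    by (simp add: blinfun.add_left algebra_simps)
qed (simp add: dual_norm_blinfun_nonneg)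

lemma dual_norm_scaleR: "dual_norm V (blinfun_apply (c *\<^sub>R f)) = \<bar>c\<bar> * dual_norm V (blinfun_apply f)"
proof -
  have le: "dual_norm V (blinfun_apply (c *\<^sub>R f)) \<le> \<bar>c\<bar> * dual_norm V (blinfun_apply f)" for c f
  proof (rule dual_norm_le[OF subspace_0[OF V]])
    show "\<bar>blinfun_apply (c *\<^sub>R f) x\<bar> \<le> \<bar>c\<bar> * dual_norm V (blinfun_apply f) * norm x" if "x \<in> V" for x
      using mult_left_mono[OF abs_blinfun_le_dual_norm[OF that, of f], of "\<bar>c\<bar>"]
      by (simp add: blinfun.scaleR_left abs_mult mult.assoc)
  qed (simp add: dual_norm_blinfun_nonneg)
  show ?thesis
  proof (cases "c = 0")
    case True
    then show ?thesis
      using le[of 0 f] dual_norm_blinfun_nonneg[of 0] by simp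
  next
    case False
    have "\<bar>c\<bar> * dual_norm V (blinfun_apply f) \<le> dual_norm V (blinfun_apply (c *\<^sub>R f))"
      using le[of "inverse c" "c *\<^sub>R f"] False by (simp add: field_simps)
    with le show ?thesis
      by (simp add: antisym)
  qed
qed

section \<open>The L-projection of an M-ideal\<close>

text \<open>
  \<open>P f\<close> agrees with \<open>f\<close> on \<open>V\<close>, which gives one inequality. For the other, a norm-preserving
  extension \<open>g\<close> of the restriction of \<open>f\<close> differs from \<open>f\<close> by an element of the kernel, so
  \<open>P f = P g\<close>, and \<open>P\<close> is a contraction.
\<close>

lemma norm_L_projection_eq_dual_norm:
  assumes P: "L_projection P" and ker: "{f. P f = 0} = annihilator V"
  shows "norm (P f) = dual_norm V (blinfun_apply f)"
proof (rule antisym)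
  have lin: "linear P" and "P \<circ> P = P" and norm_eq: "\<And>g. norm g = norm (P g) + norm (g - P g)"
    using P unfolding L_projection_def by blast+
  then have idem: "P (P g) = P g" for g
    by (metis comp_apply)
  have "P (f - P f) = 0"
    using idem by (simp add: linear_diff[OF lin])
  then have "f - P f \<in> annihilator V"
    using ker by blast
  then have "f x = P f x" if "x \<in> V" for x
    using that by (simp add: annihilator_def blinfun.diff_left)
  then show "dual_norm V (blinfun_apply f) \<le> norm (P f)"
    using norm_blinfun[of "P f"] by (intro dual_norm_le subspace_0[OF V]) auto
  obtain g :: "'a \<Rightarrow>\<^sub>L real" where g: "\<And>x. x \<in> V \<Longrightarrow> g x = restrict f V x"
      "norm g \<le> dual_norm V (restrict f V)"
    using hahn_banach_dual_space[OF V restrict_blinfun_in_dual_space[OF V]] by metis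
  have "f - g \<in> annihilator V"
    using g(1) by (simp add: annihilator_def blinfun.diff_left)
  then have "P (f - g) = 0"
    using ker by blast
  then have "P f = P g"
    by (simp add: linear_diff[OF lin])
  then show "norm (P f) \<le> dual_norm V (blinfun_apply f)"
    using norm_eq[of g] g(2) norm_ge_zero[of "g - P g"] by (simp only: dual_norm_restrict)
qed

section \<open>Small weak-star neighbourhoods in the dual of a subspace\<close>

text \<open>
  A small relatively open subset of the dual ball contains the trace of a basic neighbourhood
  of each of its points; the chosen point is extended to the whole space by Hahn--Banach.
\<close>

lemma weak_star_BHP_basic_neighbourhood:
  assumes BHP: "weak_star_BHP V" and "\<delta> > 0"
  obtains f\<^sub>0 :: "'a \<Rightarrow>\<^sub>L real" and F \<eta>
  where "norm f\<^sub>0 \<le> 1" "finite F" "F \<subseteq> V" "\<eta> > 0"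
    "\<forall>f. dual_norm V (blinfun_apply f) \<le> 1 \<and> (\<forall>y\<in>F. \<bar>f y - f\<^sub>0 y\<bar> < \<eta>) \<longrightarrow>
      dual_norm V (blinfun_apply (f - f\<^sub>0)) < \<delta>"
proof -
  obtain W where W: "openin (subtopology (weak_star_topology V) (dual_ball V)) W" "W \<noteq> {}"
      "dual_diameter V W < \<delta>"
    using BHP \<open>\<delta> > 0\<close> by (auto simp: weak_star_BHP_def)
  have "dual_space V \<inter> dual_ball V = dual_ball V"
    by (auto simp: dual_ball_def)
  then obtain T where T: "openin (powertop_real V) T" "W = T \<inter> dual_ball V"
    using W(1) by (auto simp: weak_star_topology_def subtopology_subtopology openin_subtopology)
  obtain g where g: "g \<in> W"
    using W(2) by blast
  have dual: "h \<in> dual_space V" "dual_norm V h \<le> 1" if "h \<in> W" for h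
    using that T(2) by (auto simp: dual_ball_def)
  have diam: "dual_norm V (\<lambda>x. h x - k x) < \<delta>" if "h \<in> W" "k \<in> W" for h k
  proof -
    have le1: "\<bar>h x\<bar> \<le> norm x" if "h \<in> W" "x \<in> V" for h x
      using abs_le_dual_norm[OF V dual(1)[OF that(1)] that(2)] dual(2)[OF that(1)]
        mult_right_mono[OF dual(2)[OF that(1)], of "norm x"] by simp
    \<comment> \<open>The diameter is a supremum of reals, so it bounds the distances only once these are
      known to be bounded; \<open>W\<close> lies in the unit ball.\<close>
    have "bdd_above ((\<lambda>(h, k). dual_norm V (\<lambda>x. h x - k x)) ` (W \<times> W))"
    proof (rule bdd_aboveI2[where M = 2], clarsimp)
      fix h k assume "h \<in> W" "k \<in> W"
      then show "dual_norm V (\<lambda>x. h x - k x) \<le> 2"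
        using le1 by (intro dual_norm_le subspace_0[OF V]) (auto simp: abs_le_iff, smt+)
    qed
    then have "dual_norm V (\<lambda>x. h x - k x) \<le> dual_diameter V W"
      unfolding dual_diameter_def using that by (intro cSUP_upper2[where x = "(h, k)"]) auto
    with W(3) show ?thesis by simp
  qed
  obtain f\<^sub>0 :: "'a \<Rightarrow>\<^sub>L real" where f0: "\<And>x. x \<in> V \<Longrightarrow> f\<^sub>0 x = g x" "norm f\<^sub>0 \<le> dual_norm V g"
    using hahn_banach_dual_space[OF V dual(1)[OF g]] by metis
  obtain X where X: "g \<in> PiE V X" "\<And>i. open (X i)" "finite {i. X i \<noteq> UNIV}" "PiE V X \<subseteq> T"
    using product_topology_open_contains_basis[OF T(1), of g] g T(2) by auto
  define F where "F = {i \<in> V. X i \<noteq> UNIV}"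
  have finF: "finite F"
    using X(3) by (simp add: F_def)
  have "\<exists>e>0. ball (g i) e \<subseteq> X i" if "i \<in> V" for i
    using X(1,2) that open_contains_ball by blast
  then obtain e where e: "\<And>i. i \<in> V \<Longrightarrow> e i > 0" "\<And>i. i \<in> V \<Longrightarrow> ball (g i) (e i) \<subseteq> X i"
    by metis
  \<comment> \<open>The element \<open>1\<close> covers the case that \<open>F\<close> is empty.\<close>
  define \<eta> where "\<eta> = Min (insert 1 (e ` F))"
  have \<eta>: "\<eta> > 0" "\<And>i. i \<in> F \<Longrightarrow> \<eta> \<le> e i"
    using finF e(1) by (auto simp: \<eta>_def F_def)
  show ?thesis
  proof (rule that[of f\<^sub>0 F \<eta>])
    show "norm f\<^sub>0 \<le> 1"
      using f0(2) dual(2)[OF g] by simp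
  next
    show "\<forall>f. dual_norm V (blinfun_apply f) \<le> 1 \<and> (\<forall>y\<in>F. \<bar>f y - f\<^sub>0 y\<bar> < \<eta>) \<longrightarrow>
      dual_norm V (blinfun_apply (f - f\<^sub>0)) < \<delta>"
    proof (intro allI impI, elim conjE)
      fix f :: "'a \<Rightarrow>\<^sub>L real"
      assume f: "dual_norm V (blinfun_apply f) \<le> 1" and near: "\<forall>y\<in>F. \<bar>f y - f\<^sub>0 y\<bar> < \<eta>"
      have "f y \<in> X y" if y: "y \<in> V" for y
      proof (cases "y \<in> F")
        case True
        then have "f y \<in> ball (g y) (e y)"
          using bspec[OF near, of y] \<eta>(2)[of y] f0(1)[OF y] by (simp add: dist_real_def abs_minus_commute)
        then show ?thesis
          using e(2)[OF y] by blast
      qed (use y in \<open>simp add: F_def\<close>)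
      then have "restrict f V \<in> W"
        using X(4) f restrict_blinfun_in_dual_space[OF V, of f]
        by (auto simp: T(2) dual_ball_def dual_norm_restrict)
      from diam[OF this g] have "dual_norm V (\<lambda>x. restrict f V x - g x) < \<delta>" .
      moreover have "dual_norm V (\<lambda>x. restrict f V x - g x) = dual_norm V (blinfun_apply (f - f\<^sub>0))"
        unfolding dual_norm_def by (intro SUP_cong) (auto simp: f0(1) blinfun.diff_left)
      ultimately show "dual_norm V (blinfun_apply (f - f\<^sub>0)) < \<delta>" by simp
    qed
  qed (use finF \<eta> in \<open>auto simp: F_def\<close>)
qed

lemma norm_one_functional_attained_on_subspace:
  assumes "V \<noteq> {0}"
  obtains \<phi> :: "'a \<Rightarrow>\<^sub>L real" and y where "norm \<phi> \<le> 1" "y \<in> V" "norm y = 1" "\<phi> y = 1"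
proof -
  obtain z where z: "z \<in> V" "z \<noteq> 0"
    using assms subspace_0[OF V] by blast
  define y where "y = z /\<^sub>R norm z"
  have y: "y \<in> V" "norm y = 1"
    using z subspace_scale[OF V] by (auto simp: y_def)
  then have "y \<noteq> 0"
    by auto
  define f where "f x = (THE a. x = a *\<^sub>R y)" for x
  have f: "f (a *\<^sub>R y) = a" for a
    using \<open>y \<noteq> 0\<close> by (simp add: f_def)
  have span: "\<exists>a. x = a *\<^sub>R y" if "x \<in> span {y}" for x
    using that by (auto simp: span_singleton)
  have "\<exists>\<phi> :: 'a \<Rightarrow>\<^sub>L real. (\<forall>x\<in>span {y}. blinfun_apply \<phi> x = f x) \<and> norm \<phi> \<le> 1"
  proof (rule hahn_banach[OF subspace_span])
    show "f (u + v) = f u + f v" if "u \<in> span {y}" "v \<in> span {y}" for u v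
      using span[OF that(1)] span[OF that(2)] by (auto simp: f scaleR_add_left[symmetric])
    show "f (c *\<^sub>R u) = c * f u" if "u \<in> span {y}" for c u
      using span[OF that] by (auto simp: f)
    show "\<bar>f u\<bar> \<le> 1 * norm u" if "u \<in> span {y}" for u
      using span[OF that] y(2) by (auto simp: f)
  qed simp
  then obtain \<phi> :: "'a \<Rightarrow>\<^sub>L real" where \<phi>: "\<And>x. x \<in> span {y} \<Longrightarrow> \<phi> x = f x" "norm \<phi> \<le> 1"
    by blast
  have "\<phi> y = 1"
    using \<phi>(1)[of y] f[of 1] by (simp add: span_base)
  then show ?thesis
    using that \<phi>(2) y by blast
qed

text \<open>
  The huskable property yields a small neighbourhood of some \<open>f\<^sub>0\<close>, possibly deep inside the ball.
  If the restriction of \<open>f\<^sub>0\<close> has norm at most \<open>1 - \<delta>\<close>, then every \<open>u\<close> that is small on \<open>F\<close> has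
  restriction norm at most \<open>\<delta>\<close>: otherwise shrink \<open>u\<close> to restriction norm exactly \<open>\<delta>\<close>. It remains
  small on \<open>F\<close>, and \<open>f\<^sub>0 + u\<close> remains in the ball of the dual of \<open>V\<close>, so the restriction norm of
  \<open>u\<close> must be strictly less than \<open>\<delta>\<close>. Thus the same \<open>F\<close> and \<open>\<eta>\<close> serve at every functional, in particular at
  one that attains norm one on \<open>V\<close>.
\<close>

lemma weak_star_BHP_near_sphere:
  assumes BHP: "weak_star_BHP V" and nontriv: "V \<noteq> {0}" and \<delta>: "\<delta> > 0"
  obtains \<phi> :: "'a \<Rightarrow>\<^sub>L real" and y F \<eta>
  where "norm \<phi> \<le> 1" "y \<in> V" "norm y \<le> 1" "\<phi> y > 1 - \<delta>" "finite F" "\<eta> > 0"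
    "\<forall>f. norm f \<le> 1 \<and> (\<forall>z\<in>F. \<bar>blinfun_apply f z - \<phi> z\<bar> < \<eta>) \<longrightarrow>
      dual_norm V (blinfun_apply (f - \<phi>)) \<le> \<delta>"
proof -
  let ?N = "\<lambda>f :: 'a \<Rightarrow>\<^sub>L real. dual_norm V (blinfun_apply f)"
  obtain f\<^sub>0 :: "'a \<Rightarrow>\<^sub>L real" and F \<eta> where f0: "norm f\<^sub>0 \<le> 1" and F: "finite F" "F \<subseteq> V" "\<eta> > 0"
    and small: "\<forall>f. ?N f \<le> 1 \<and> (\<forall>z\<in>F. \<bar>f z - f\<^sub>0 z\<bar> < \<eta>) \<longrightarrow> ?N (f - f\<^sub>0) < \<delta>"
    by (rule weak_star_BHP_basic_neighbourhood[OF BHP \<delta>])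
  show ?thesis
  proof (cases "?N f\<^sub>0 > 1 - \<delta>")
    case True
    have "V \<inter> cball 0 1 \<noteq> {}"
      using subspace_0[OF V] by auto
    have "\<exists>x\<in>V \<inter> cball 0 1. 1 - \<delta> < \<bar>f\<^sub>0 x\<bar>"
    proof (rule ccontr)
      assume "\<not> (\<exists>x\<in>V \<inter> cball 0 1. 1 - \<delta> < \<bar>f\<^sub>0 x\<bar>)"
      then have "?N f\<^sub>0 \<le> 1 - \<delta>"
        unfolding dual_norm_def using \<open>V \<inter> cball 0 1 \<noteq> {}\<close> by (intro cSUP_least) (auto simp: not_less)
      with True show False
        by simp
    qed
    then obtain x where x: "x \<in> V" "norm x \<le> 1" "1 - \<delta> < \<bar>f\<^sub>0 x\<bar>"
      by auto
    \<comment> \<open>The supremum of the absolute values is also approached by the values themselves.\<close>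
    define y where "y = (if f\<^sub>0 x < 0 then - x else x)"
    have y: "y \<in> V" "norm y \<le> 1" "f\<^sub>0 y > 1 - \<delta>"
      using x subspace_neg[OF V] by (auto simp: y_def blinfun.minus_right)
    show ?thesis
      using small dual_norm_le_norm by (intro that[OF f0 y F(1,3)]) (meson less_imp_le order_trans)
  next
    case False
    have absorb: "?N u \<le> \<delta>" if u: "\<And>z. z \<in> F \<Longrightarrow> \<bar>u z\<bar> < \<eta>" for u :: "'a \<Rightarrow>\<^sub>L real"
    proof (rule ccontr)
      assume "\<not> ?N u \<le> \<delta>"
      define c where "c = \<delta> / ?N u"
      have c: "0 < c" "c \<le> 1" "?N (c *\<^sub>R u) = \<delta>"
        using \<open>\<not> ?N u \<le> \<delta>\<close> \<delta> by (auto simp: c_def dual_norm_scaleR)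
      have "?N (f\<^sub>0 + c *\<^sub>R u) \<le> 1"
        using dual_norm_add_le[of f\<^sub>0 "c *\<^sub>R u"] c(3) False by simp
      moreover have "\<bar>(f\<^sub>0 + c *\<^sub>R u) z - f\<^sub>0 z\<bar> < \<eta>" if "z \<in> F" for z
      proof -
        have "\<bar>(f\<^sub>0 + c *\<^sub>R u) z - f\<^sub>0 z\<bar> = c * \<bar>u z\<bar>"
          using c(1) by (simp add: blinfun.add_left blinfun.scaleR_left abs_mult)
        also have "\<dots> \<le> \<bar>u z\<bar>"
          using c by (simp add: mult_left_le_one_le)
        finally show ?thesis
          using u[OF that] by simp
      qed
      ultimately have "?N (f\<^sub>0 + c *\<^sub>R u - f\<^sub>0) < \<delta>"
        using small by blast
      with c(3) show False
        by simp
    qed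
    obtain \<phi> :: "'a \<Rightarrow>\<^sub>L real" and y where \<phi>: "norm \<phi> \<le> 1" "y \<in> V" "norm y = 1" "\<phi> y = 1"
      using norm_one_functional_attained_on_subspace[OF nontriv] by blast
    show ?thesis
      by (rule that[of \<phi> y F \<eta>]) (use \<phi> F \<delta> absorb in \<open>auto simp: blinfun.diff_left\<close>)
  qed
qed

end

section \<open>Lifting the ball huskable property from an M-ideal\<close>

lemma openin_strong_operator_topology_finite:
  fixes A :: "'a::real_normed_vector \<Rightarrow> 'b::real_normed_vector set"
  assumes "finite F" "\<And>z. z \<in> F \<Longrightarrow> open (A z)"
  shows "openin strong_operator_topology {f. \<forall>z\<in>F. blinfun_apply f z \<in> A z}"
  using assms
proof (induction rule: finite_induct)
  case empty
  show ?case
    using openin_topspace[of "strong_operator_topology :: ('a \<Rightarrow>\<^sub>L 'b) topology"]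
    by (simp add: strong_operator_topology_topspace)
next
  case (insert z F)
  have "openin strong_operator_topology {f. blinfun_apply f z \<in> A z}"
    using openin_continuous_map_preimage[OF strong_operator_topology_continuous_evaluation[of z], of "A z"]
      insert.prems by (simp add: strong_operator_topology_topspace)
  then have "openin strong_operator_topology
      ({f. blinfun_apply f z \<in> A z} \<inter> {f. \<forall>z\<in>F. blinfun_apply f z \<in> A z})"
    using insert by (intro openin_Int) auto
  then show ?case
    by (simp add: Collect_conj_eq)
qed

theorem proposition2p6:
  fixes Y :: "'a::banach set"
  assumes "M_ideal Y" and "Y \<noteq> {0}" and "weak_star_BHP Y"
  shows "weak_star_BHP (UNIV :: 'a set)"
  unfolding weak_star_BHP_UNIV_iff
proof (intro allI impI)
  fix \<epsilon> :: real assume "\<epsilon> > 0"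
  \<comment> \<open>The diameter below is at most \<open>4\<delta>\<close>: two errors \<open>\<delta>\<close> for each of two functionals.\<close>
  define \<delta> where "\<delta> = \<epsilon> / 5"
  have \<delta>: "\<delta> > 0" "4 * \<delta> < \<epsilon>"
    using \<open>\<epsilon> > 0\<close> by (auto simp: \<delta>_def)
  obtain P :: "('a \<Rightarrow>\<^sub>L real) \<Rightarrow> ('a \<Rightarrow>\<^sub>L real)" where Y: "subspace Y"
    and P: "L_projection P" "{f. P f = 0} = annihilator Y"
    using assms(1) by (auto simp: M_ideal_def)
  note norm_P = norm_L_projection_eq_dual_norm[OF Y P]
  obtain \<phi> :: "'a \<Rightarrow>\<^sub>L real" and y F \<eta>
    where \<phi>: "norm \<phi> \<le> 1" and y: "y \<in> Y" "norm y \<le> 1" "\<phi> y > 1 - \<delta>"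
      and F: "finite F" "\<eta> > 0"
      and near: "\<forall>f. norm f \<le> 1 \<and> (\<forall>z\<in>F. \<bar>blinfun_apply f z - \<phi> z\<bar> < \<eta>) \<longrightarrow>
        dual_norm Y (blinfun_apply (f - \<phi>)) \<le> \<delta>"
    by (rule weak_star_BHP_near_sphere[OF Y assms(3,2) \<delta>(1)])
  define S where "S = {f :: 'a \<Rightarrow>\<^sub>L real. (\<forall>z\<in>F. \<bar>f z - \<phi> z\<bar> < \<eta>) \<and> f y > 1 - \<delta>}"
  let ?U = "S \<inter> cball 0 1"
  have "openin strong_operator_topology S"
  proof -
    have "S = {f. \<forall>z\<in>F. blinfun_apply f z \<in> ball (\<phi> z) \<eta>} \<inter> {f. \<forall>z\<in>{y}. blinfun_apply f z \<in> {1 - \<delta><..}}"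
      by (auto simp: S_def dist_real_def abs_minus_commute)
    also have "openin strong_operator_topology \<dots>"
      using F(1) by (intro openin_Int openin_strong_operator_topology_finite) auto
    finally show ?thesis .
  qed
  then have "openin (subtopology strong_operator_topology (cball 0 1)) ?U"
    by (auto simp: openin_subtopology)
  moreover have "\<phi> \<in> ?U"
    using \<phi> y F by (simp add: S_def)
  moreover have "diameter ?U \<le> 4 * \<delta>"
  proof (rule diameter_le)
    have lin: "linear P" and norm_eq: "\<And>f. norm f = norm (P f) + norm (f - P f)"
      using P(1) unfolding L_projection_def by blast+
    \<comment> \<open>The condition at \<open>y\<close> leaves \<open>P f\<close> almost all of the norm of \<open>f\<close>, and the condition on \<open>F\<close>
      keeps \<open>P f\<close> close to \<open>P \<phi>\<close>.\<close>
    have rest: "norm (f - P f) \<le> \<delta>" and close: "norm (P f - P \<phi>) \<le> \<delta>" if "f \<in> ?U" for f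
    proof -
      have "1 - \<delta> < f y"
        using that by (simp add: S_def)
      also have "\<dots> \<le> norm (P f)"
        using abs_blinfun_le_dual_norm[OF Y y(1), of f] y(2) mult_left_le[OF y(2), of "norm (P f)"]
        by (simp add: norm_P[symmetric])
      finally show "norm (f - P f) \<le> \<delta>"
        using norm_eq[of f] that by simp
      show "norm (P f - P \<phi>) \<le> \<delta>"
        using near that norm_P[of "f - \<phi>"] by (simp add: S_def linear_diff[OF lin])
    qed
    fix f g assume fg: "f \<in> ?U" "g \<in> ?U"
    have "f - g = (f - P f) + (P f - P \<phi>) - ((g - P g) + (P g - P \<phi>))"
      by simp
    also have "norm \<dots> \<le> (norm (f - P f) + norm (P f - P \<phi>)) + (norm (g - P g) + norm (P g - P \<phi>))"
      by (meson add_mono norm_triangle_ineq norm_triangle_ineq4 order_trans)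
    also have "\<dots> \<le> 4 * \<delta>"
      using rest[OF fg(1)] close[OF fg(1)] rest[OF fg(2)] close[OF fg(2)] by simp
    finally show "norm (f - g) \<le> 4 * \<delta>" .
  qed (use \<delta> in simp)
  ultimately show "\<exists>U :: ('a \<Rightarrow>\<^sub>L real) set.
      openin (subtopology strong_operator_topology (cball 0 1)) U \<and> U \<noteq> {} \<and> diameter U < \<epsilon>"
    using \<delta>(2) by (intro exI[of _ ?U]) auto
qed

end
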